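(* Let $\lambda$ be a nonzero real number, let $Y_1,Y_2,\dots$ be independent Bernoulli random variables each with success probability $1/2$, and let $Y^{(k)}=Y_1+\cdots+Y_k$ for $k\ge1$, $Y^{(0)}=0$. Let $m,l$ be integers with $m\ge l\ge0$. Then for all integers $n\ge0$, \[ E\Big[S_{n,\lambda}^{Y^{(m)}}\big(x+Y^{(l)}\big)\Big]=\mathcal{E}_{n,\lambda}^{(m-l)}(x). \]
   Context: For a nonzero real $\lambda$ and any $x$, set $(x)_{0,\lambda}=1$ and $(x)_{n,\lambda}=x(x-\lambda)\cdots(x-(n-1)\lambda)$ for $n\ge1$, $e_{\lambda}^{x}(t)=\sum_{k\ge0}(x)_{k,\lambda}\frac{t^k}{k!}=(1+\lambda t)^{x/\lambda}$, $e_\lambda(t)=e_\lambda^1(t)$. Higher-order degenerate Euler polynomials: $\left(\frac{2}{e_\lambda(t)+1}\right)^{\alpha}e_\lambda^x(t)=\sum_{n\ge0}\mathcal{E}_{n,\lambda}^{(\alpha)}(x)\frac{t^n}{n!}$. For a random variable $Z$ whose moment generating function exists near $0$, the degenerate Sheffer polynomials associated with $Z$ are defined by $\frac{1}{E[e_\lambda^{Z}(t)]}\,e_\lambda^x(t)=\sum_{n\ge0}S_{n,\lambda}^{Z}(x)\frac{t^n}{n!}$, where $E[e_\lambda^Z(t)]=E[(1+\lambda t)^{Z/\lambda}]$. In the claim, $Y^{(l)}$ and $Y^{(m)}$ are built from the same sequence; the expectation is over $Y^{(l)}$. *)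

theory Defs
  imports "HOL-Probability.Probability"
begin

definition degen_fact :: "real \<Rightarrow> real \<Rightarrow> nat \<Rightarrow> real" where
  "degen_fact lam x n = (\<Prod>i<n. x - real i * lam)"

(* The series converges for \<bar>lam * t\<bar> < 1; only its values near t = 0 are used below. *)
definition degen_exp :: "real \<Rightarrow> real \<Rightarrow> real \<Rightarrow> real" where
  "degen_exp lam x t = (\<Sum>k. degen_fact lam x k * t ^ k / fact k)"

(* The sequence a with f t = (\<Sum>n. a n * t ^ n / fact n) for all t in a neighbourhood of 0.
   It is unspecified if f has no convergent power series expansion at 0. *)
definition egf_coeffs :: "(real \<Rightarrow> real) \<Rightarrow> nat \<Rightarrow> real" where
  "egf_coeffs f = (THE a. f has_fps_expansion Abs_fps (\<lambda>n. a n / fact n))"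

(* The base of the power tends to 1 as t tends to 0, so it is positive near 0 and
   powr is the usual power there, for every real order a. *)
definition degen_Euler :: "real \<Rightarrow> real \<Rightarrow> nat \<Rightarrow> real \<Rightarrow> real" where
  "degen_Euler lam a n x =
     egf_coeffs (\<lambda>t. (2 / (degen_exp lam 1 t + 1)) powr a * degen_exp lam x t) n"

(* Meant for random variables Z on M whose moment generating function exists near 0. *)
definition degen_Sheffer ::
    "'a measure \<Rightarrow> ('a \<Rightarrow> real) \<Rightarrow> real \<Rightarrow> nat \<Rightarrow> real \<Rightarrow> real" where
  "degen_Sheffer M Z lam n x =
     egf_coeffs (\<lambda>t. 1 / (\<integral>\<omega>. degen_exp lam (Z \<omega>) t \<partial>M) * degen_exp lam x t) n"

lemma degen_exp_eq_powr:
  assumes "lam \<noteq> 0" "\<bar>lam * t\<bar> < 1"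
  shows "(\<lambda>k. degen_fact lam x k * t ^ k / fact k) sums (1 + lam * t) powr (x / lam)"
    and "degen_exp lam x t = (1 + lam * t) powr (x / lam)"
proof -
  have *: "((x / lam) gchoose k) * (lam * t) ^ k = degen_fact lam x k * t ^ k / fact k" for k
  proof -
    have "((x / lam) gchoose k) * lam ^ k = (\<Prod>i<k. (x / lam - real i) * lam) / fact k"
      by (simp add: gbinomial_prod_rev prod.distrib atLeast0LessThan)
    also have "(\<Prod>i<k. (x / lam - real i) * lam) = degen_fact lam x k"
      unfolding degen_fact_def using assms(1) by (intro prod.cong) (auto simp: field_simps)
    finally show ?thesis
      by (simp add: power_mult_distrib flip: mult.assoc)
  qed
  show "(\<lambda>k. degen_fact lam x k * t ^ k / fact k) sums (1 + lam * t) powr (x / lam)"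
    using gen_binomial_real[OF assms(2), of "x / lam"] unfolding * .
  then show "degen_exp lam x t = (1 + lam * t) powr (x / lam)"
    unfolding degen_exp_def by (simp add: sums_iff)
qed

lemma fps_eqI_eventually_real:
  fixes F G :: "real fps"
  assumes "fps_conv_radius F > 0" "fps_conv_radius G > 0"
    and "eventually (\<lambda>t. eval_fps F t = eval_fps G t) (nhds 0)"
  shows "fps_nth F n = fps_nth G n"
  using assms
proof (induction n arbitrary: F G)
  case 0
  from eventually_nhds_x_imp_x[OF "0.prems"(3)] show ?case
    by (simp add: eval_fps_at_0)
next
  case (Suc n F G)
  let ?r = "min (fps_conv_radius F) (fps_conv_radius G)"
  have "eventually (\<lambda>t::real. t \<in> eball 0 ?r) (nhds 0)"
    using Suc.prems by (intro eventually_nhds_in_open) (auto simp: zero_ereal_def)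
  moreover have "eventually (\<lambda>t. eventually (\<lambda>t. eval_fps F t = eval_fps G t) (nhds t)) (nhds 0)"
    using Suc.prems(3) by (simp add: eventually_eventually)
  ultimately have "eventually (\<lambda>t. eval_fps (fps_deriv F) t = eval_fps (fps_deriv G) t) (nhds 0)"
    by eventually_elim (auto simp: eval_fps_deriv intro: deriv_cong_ev)
  then have "fps_nth (fps_deriv F) n = fps_nth (fps_deriv G) n"
    using Suc.prems fps_conv_radius_deriv[of F] fps_conv_radius_deriv[of G]
    by (intro Suc.IH) auto
  then show ?case by (simp del: of_nat_Suc)
qed

lemma egf_coeffs_eqI:
  assumes "f has_fps_expansion Abs_fps (\<lambda>n. a n / fact n)"
  shows "egf_coeffs f = a"
  unfolding egf_coeffs_def
proof (rule the_equality, fact assms)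
  fix b assume b: "f has_fps_expansion Abs_fps (\<lambda>n. b n / fact n)"
  let ?F = "\<lambda>c. Abs_fps (\<lambda>n. c n / fact n :: real)"
  have "eventually (\<lambda>t. eval_fps (?F b) t = f t) (nhds 0)"
    and "eventually (\<lambda>t. eval_fps (?F a) t = f t) (nhds 0)"
    using b assms by (auto simp: has_fps_expansion_def)
  then have "eventually (\<lambda>t. eval_fps (?F b) t = eval_fps (?F a) t) (nhds 0)"
    by eventually_elim simp
  then have "fps_nth (?F b) n = fps_nth (?F a) n" for n
    using b assms by (intro fps_eqI_eventually_real) (auto simp: has_fps_expansion_def)
  then show "b = a" by (intro ext) simp
qed

end

theory Submission
  imports Defs
begin

text \<open>If \<open>e\<close> denotes \<open>degen_exp lam 1\<close>, then \<open>degen_exp lam y\<close> is multiplicative in \<open>y\<close>, so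
  adding an independent fair Bernoulli variable to \<open>y\<close> multiplies its mean by \<open>(e + 1) / 2\<close>. Hence
  the generating function of the Sheffer polynomials of \<open>Y\<^sup>(\<^sup>m\<^sup>)\<close>, evaluated at \<open>x + Y\<^sup>(\<^sup>l\<^sup>)\<close>, has
  mean \<open>(2 / (e + 1))\<^sup>m ((e + 1) / 2)\<^sup>l degen_exp lam x\<close>. As \<open>Y\<^sup>(\<^sup>l\<^sup>)\<close> takes finitely many values,
  the mean is a finite sum and commutes with taking coefficients.\<close>

text \<open>Almost surely the indices with value 1 form exactly one subset \<open>B\<close> of
  \<open>I\<close>, and by independence each \<open>B\<close> occurs with probability
  \<open>1 / 2 ^ card I\<close>. Summing over subsets instead of over values of the sum avoids
  binomial coefficients.\<close>

lemma (in prob_space) expectation_sum_bernoulli_half: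
  fixes Y :: "'i \<Rightarrow> 'a \<Rightarrow> real" and h :: "real \<Rightarrow> real"
  assumes fin: "finite I" and indep: "indep_vars (\<lambda>_. borel) Y I"
    and distr: "\<And>i. i \<in> I \<Longrightarrow> distr M borel (Y i) = distr (bernoulli_pmf (1/2)) borel of_bool"
    and h: "h \<in> borel_measurable borel"
  shows "expectation (\<lambda>\<omega>. h (\<Sum>i\<in>I. Y i \<omega>)) = (\<Sum>B\<in>Pow I. h (real (card B))) / 2 ^ card I"
proof -
  have meas [measurable]: "Y i \<in> borel_measurable M" if "i \<in> I" for i
    using indep that by (auto simp: indep_vars_def)
  note h [measurable]
  \<comment> \<open>The law of \<open>Y i\<close> determines its values only almost everywhere, so
    the pointwise expansion below is an almost sure identity.\<close>
  have AE_01: "AE \<omega> in M. \<forall>i\<in>I. Y i \<omega> \<in> {0, 1}"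
  proof (subst AE_finite_all[OF fin], intro ballI)
    fix i assume i: "i \<in> I"
    have "AE y in distr (bernoulli_pmf (1/2)) borel of_bool. (y::real) \<in> {0, 1}"
      by (subst AE_distr_iff) auto
    then have "AE y in distr M borel (Y i). y \<in> {0, 1}"
      unfolding distr[OF i] .
    then show "AE \<omega> in M. Y i \<omega> \<in> {0, 1}"
      using meas[OF i] by (subst (asm) AE_distr_iff) auto
  qed
  \<comment> \<open>\<open>?J B i\<close> tests whether \<open>Y i\<close> has the value prescribed
    by the pattern \<open>B\<close>; its product over \<open>I\<close> is the indicator of the event
    that \<open>B\<close> is the set of successes.\<close>
  let ?J = "\<lambda>B i \<omega>. indicator {of_bool (i \<in> B)} (Y i \<omega>) :: real"
  have J: "expectation (?J B i) = 1 / 2" if i: "i \<in> I" for B i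
  proof -
    have "expectation (?J B i) = (\<integral>y. indicator {of_bool (i \<in> B)} y \<partial>distr M borel (Y i))"
      using meas[OF i] by (subst integral_distr) auto
    also have "\<dots> = measure_pmf.expectation (bernoulli_pmf (1/2))
        (\<lambda>b. indicator {of_bool (i \<in> B) :: real} (of_bool b))"
      unfolding distr[OF i] by (subst integral_distr) auto
    also have "\<dots> = 1 / 2" by (cases "i \<in> B") auto
    finally show ?thesis .
  qed
  have int: "integrable M (?J B i)" if "i \<in> I" for B i
    using that by (intro integrable_const_bound[where B = 1]) (auto simp: indicator_def)
  have indJ: "indep_vars (\<lambda>_. borel) (?J B) I" for B
    by (rule indep_vars_compose2[OF indep, of "\<lambda>i. indicator {of_bool (i \<in> B)}"]) simp
  have prodJ: "expectation (\<lambda>\<omega>. \<Prod>i\<in>I. ?J B i \<omega>) = (1 / 2) ^ card I" for B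
    using indep_vars_lebesgue_integral[OF fin indJ int] J by simp
  have intJ: "integrable M (\<lambda>\<omega>. \<Prod>i\<in>I. ?J B i \<omega>)" for B
    using indep_vars_integrable[OF fin indJ int] .
  have "expectation (\<lambda>\<omega>. h (\<Sum>i\<in>I. Y i \<omega>))
      = expectation (\<lambda>\<omega>. \<Sum>B\<in>Pow I. h (real (card B)) * (\<Prod>i\<in>I. ?J B i \<omega>))"
  proof (rule integral_cong_AE)
    show "AE \<omega> in M. h (\<Sum>i\<in>I. Y i \<omega>) = (\<Sum>B\<in>Pow I. h (real (card B)) * (\<Prod>i\<in>I. ?J B i \<omega>))"
      using AE_01
    proof eventually_elim
      fix \<omega> assume 01: "\<forall>i\<in>I. Y i \<omega> \<in> {0, 1}"
      define C where "C = {i \<in> I. Y i \<omega> = 1}"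
      have C: "C \<in> Pow I" "\<And>i. i \<in> I \<Longrightarrow> Y i \<omega> = of_bool (i \<in> C)"
        using 01 by (auto simp: C_def)
      have "(\<Prod>i\<in>I. ?J B i \<omega>) = of_bool (B = C)" if B: "B \<in> Pow I" for B
      proof (cases "B = C")
        case False
        then obtain i where "i \<in> I" "(i \<in> B) \<noteq> (i \<in> C)" using B C(1) by blast
        then have "?J B i \<omega> = 0" using C(2) by auto
        then have "(\<Prod>i\<in>I. ?J B i \<omega>) = 0"
          using \<open>i \<in> I\<close> by (intro prod_zero[OF fin] bexI)
        then show ?thesis using False by simp
      qed (simp add: C(2))
      then have "(\<Sum>B\<in>Pow I. h (real (card B)) * (\<Prod>i\<in>I. ?J B i \<omega>))
          = (\<Sum>B\<in>Pow I. if B = C then h (real (card B)) else 0)"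
        by (intro sum.cong) auto
      also have "\<dots> = h (real (card C))" using C(1) fin by simp
      also have "real (card C) = (\<Sum>i\<in>I. Y i \<omega>)"
      proof -
        have "(\<Sum>i\<in>I. Y i \<omega>) = (\<Sum>i\<in>I. if i \<in> C then 1 else 0)"
          using C(2) by (intro sum.cong) auto
        then show ?thesis using C(1) fin by (simp add: sum.If_cases Int_absorb1)
      qed
      finally show "h (\<Sum>i\<in>I. Y i \<omega>) = (\<Sum>B\<in>Pow I. h (real (card B)) * (\<Prod>i\<in>I. ?J B i \<omega>))" ..
    qed
  qed auto
  also have "\<dots> = (\<Sum>B\<in>Pow I. h (real (card B)) * (1 / 2) ^ card I)"
    by (subst Bochner_Integration.integral_sum) (simp_all add: intJ prodJ)
  also have "\<dots> = (\<Sum>B\<in>Pow I. h (real (card B))) / 2 ^ card I"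
    by (simp add: sum_distrib_right power_divide sum_divide_distrib)
  finally show ?thesis .
qed

text \<open>Expanding a product of \<open>card A\<close> factors \<open>c + 1\<close> means choosing
  the factors that contribute \<open>c\<close>. This evaluates the sum over success patterns when
  \<open>h\<close> is exponential.\<close>

lemma sum_Pow_power_card:
  fixes c :: "'b::comm_semiring_1"
  assumes "finite A"
  shows "(\<Sum>B\<in>Pow A. c ^ card B) = (c + 1) ^ card A"
  using prod_add[OF assms, of "\<lambda>_. c" "\<lambda>_. 1"] by simp

text \<open>The neighbourhood of 0 must not depend on \<open>y\<close>, since \<open>y\<close> will
  run through the values of a random variable under the expectation.\<close>

lemma eventually_degen_exp_eq_powr:
  assumes "lam \<noteq> 0"
  shows "\<forall>\<^sub>F t in nhds 0. 1 + lam * t > 0 \<and> (\<forall>y. degen_exp lam y t = (1 + lam * t) powr (y / lam))"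
proof -
  have "((\<lambda>t. \<bar>lam * t\<bar>) \<longlongrightarrow> \<bar>lam * 0\<bar>) (nhds 0)"
    by (intro tendsto_intros filterlim_ident)
  then have "\<forall>\<^sub>F t in nhds 0. \<bar>lam * t\<bar> < 1"
    by (rule order_tendstoD) simp
  then show ?thesis
    by eventually_elim (use assms in \<open>auto simp: degen_exp_eq_powr(2)\<close>)
qed

lemma has_fps_expansion_degen_exp:
  assumes "lam \<noteq> 0"
  shows "degen_exp lam y has_fps_expansion Abs_fps (\<lambda>n. degen_fact lam y n / fact n)"
proof -
  let ?F = "Abs_fps (\<lambda>n. degen_fact lam y n / fact n)"
  \<comment> \<open>Convergence at a single nonzero point suffices for a positive radius; at this
    one \<open>lam * t = 1 / 2\<close>, where the binomial series converges.\<close>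
  have "summable (\<lambda>n. fps_nth ?F n * (1 / (2 * lam)) ^ n)"
    using degen_exp_eq_powr(1)[of lam "1 / (2 * lam)" y] assms by (auto simp: sums_iff)
  then have "fps_conv_radius ?F \<ge> norm (1 / (2 * lam))"
    unfolding fps_conv_radius_def by (rule conv_radius_geI)
  moreover have "ereal (norm (1 / (2 * lam))) > 0" using assms by simp
  ultimately have "fps_conv_radius ?F > 0" by (rule less_le_trans[rotated])
  then show ?thesis
    by (simp add: has_fps_expansion_def eval_fps_def degen_exp_def)
qed

lemma has_fps_expansion_eventually_eq:
  assumes "f has_fps_expansion F" "\<forall>\<^sub>F t in nhds 0. g t = f t"
  shows "g has_fps_expansion F"
proof -
  have "\<forall>\<^sub>F t in nhds 0. eval_fps F t = f t" and "fps_conv_radius F > 0"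
    using assms(1) by (auto simp: has_fps_expansion_def)
  moreover from this(1) assms(2) have "\<forall>\<^sub>F t in nhds 0. eval_fps F t = g t"
    by eventually_elim simp
  ultimately show ?thesis by (simp add: has_fps_expansion_def)
qed

text \<open>Replaces the definite description by a coefficient of a formal power series, which is
  linear in the series.\<close>

lemma egf_coeffs_eq_fps_nth:
  assumes "f has_fps_expansion F"
  shows "egf_coeffs f n = fact n * fps_nth F n"
proof -
  have "Abs_fps (\<lambda>n. (fact n * fps_nth F n) / fact n) = F" by (simp add: fps_eq_iff)
  then have "egf_coeffs f = (\<lambda>n. fact n * fps_nth F n)"
    using assms by (intro egf_coeffs_eqI) simp
  then show ?thesis by simp
qed

theorem theorem3p7:
  fixes M :: "'a measure"
    and Y :: "nat \<Rightarrow> 'a \<Rightarrow> real"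
    and lam x :: real
    and m l n :: nat
  assumes "lam \<noteq> 0"
    and "prob_space M"
    and "prob_space.indep_vars M (\<lambda>_. borel) Y {1..}"
    and "\<And>i. i \<ge> 1 \<Longrightarrow> distr M borel (Y i) = distr (bernoulli_pmf (1/2)) borel of_bool"
    and "l \<le> m"
  shows "prob_space.expectation M
           (\<lambda>\<omega>. degen_Sheffer M (\<lambda>\<omega>'. \<Sum>i=1..m. Y i \<omega>') lam n (x + (\<Sum>i=1..l. Y i \<omega>)))
         = degen_Euler lam (real (m - l)) n x"
proof -
  interpret prob_space M by fact
  \<comment> \<open>Used with \<open>k = m\<close> for the denominator in the Sheffer generating
    function and with \<open>k = l\<close> for the outer expectation; \<open>k = 0\<close> is the
    empty sum.\<close>
  have E: "expectation (\<lambda>\<omega>. h (\<Sum>i=1..k. Y i \<omega>)) = (\<Sum>B\<in>Pow {1..k}. h (real (card B))) / 2 ^ k"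
    if "h \<in> borel_measurable borel" for h :: "real \<Rightarrow> real" and k
    using expectation_sum_bernoulli_half[OF _ indep_vars_subset[OF assms(3)] assms(4), of "{1..k}" h] that
    by simp
  let ?Z = "\<lambda>\<omega>. \<Sum>i=1..m. Y i \<omega>"
  let ?e = "degen_exp lam 1"
  let ?g = "\<lambda>t. 1 / ((?e t + 1) / 2) ^ m"
  define P where "P y = Abs_fps (\<lambda>n. degen_fact lam y n / fact n)" for y
  have P: "degen_exp lam y has_fps_expansion P y" for y
    unfolding P_def by (rule has_fps_expansion_degen_exp) fact
  have ev: "\<forall>\<^sub>F t in nhds 0. ?e t > 0 \<and>
      (\<forall>y k. degen_exp lam (y + real k) t = degen_exp lam y t * ?e t ^ k) \<and>
      expectation (\<lambda>\<omega>. degen_exp lam (?Z \<omega>) t) = ((?e t + 1) / 2) ^ m"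
    using eventually_degen_exp_eq_powr[OF assms(1)]
  proof eventually_elim
    fix t assume t: "1 + lam * t > 0 \<and> (\<forall>y. degen_exp lam y t = (1 + lam * t) powr (y / lam))"
    then have pos: "1 + lam * t > 0" and eq: "\<And>y. degen_exp lam y t = (1 + lam * t) powr (y / lam)"
      by auto
    have shift: "degen_exp lam (y + real k) t = degen_exp lam y t * ?e t ^ k" for y k
      using pos by (simp add: eq add_divide_distrib powr_add powr_powr flip: powr_realpow)
    have "degen_exp lam (real k) t = ?e t ^ k" for k
      using shift[of 0 k] pos by (simp add: eq)
    moreover have "(\<lambda>y. degen_exp lam y t) \<in> borel_measurable borel"
      unfolding eq by measurable
    ultimately have "expectation (\<lambda>\<omega>. degen_exp lam (?Z \<omega>) t) = ((?e t + 1) / 2) ^ m"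
      by (subst E) (simp_all add: sum_Pow_power_card power_divide)
    with shift pos show "?e t > 0 \<and>
      (\<forall>y k. degen_exp lam (y + real k) t = degen_exp lam y t * ?e t ^ k) \<and>
      expectation (\<lambda>\<omega>. degen_exp lam (?Z \<omega>) t) = ((?e t + 1) / 2) ^ m"
      by (simp add: eq)
  qed
  obtain G where G: "?g has_fps_expansion G"
  proof -
    \<comment> \<open>The series of \<open>(?e t + 1) / 2\<close> has constant term 1, so it can be
      inverted.\<close>
    have "(\<lambda>t. \<Prod>i<m. inverse ((?e t + 1) * (1 / 2))) has_fps_expansion
        (\<Prod>i<m. inverse ((P 1 + 1) * fps_const (1 / 2)))"
      by (intro has_fps_expansion_prod has_fps_expansion_inverse has_fps_expansion_mult
            has_fps_expansion_add P has_fps_expansion_1 has_fps_expansion_const)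
        (simp add: P_def degen_fact_def)
    then show ?thesis by (intro that) (simp add: field_simps)
  qed
  have Sheffer: "(\<lambda>t. 1 / expectation (\<lambda>\<omega>. degen_exp lam (?Z \<omega>) t) * degen_exp lam y t)
      has_fps_expansion G * P y" for y
  proof -
    have "(\<lambda>t. ?g t * degen_exp lam y t) has_fps_expansion G * P y"
      by (intro has_fps_expansion_mult G P)
    then show ?thesis
      by (rule has_fps_expansion_eventually_eq) (use ev in \<open>auto elim: eventually_mono\<close>)
  qed
  have S: "degen_Sheffer M ?Z lam n y = fact n * fps_nth (G * P y) n" for y n
    unfolding degen_Sheffer_def by (rule egf_coeffs_eq_fps_nth[OF Sheffer])
  \<comment> \<open>The average, over the \<open>2 ^ l\<close> patterns of the first
    \<open>l\<close> variables, of the Sheffer generating series at the shifted argument.\<close>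
  let ?H = "\<Sum>B\<in>Pow {1..l}. fps_const (1 / 2 ^ l) * (G * P (x + real (card B)))"
  \<comment> \<open>By \<open>S\<close> the value is a polynomial in the argument, hence
    measurable.\<close>
  have "(\<lambda>\<omega>. degen_Sheffer M ?Z lam n (x + \<omega>)) \<in> borel_measurable borel"
    unfolding S by (simp add: fps_mult_nth P_def degen_fact_def)
  then have "expectation (\<lambda>\<omega>. degen_Sheffer M ?Z lam n (x + (\<Sum>i=1..l. Y i \<omega>)))
      = fact n * fps_nth ?H n"
    by (subst E) (simp_all add: S[simplified] fps_sum_nth sum_divide_distrib sum_distrib_left)
  also have "\<dots> = degen_Euler lam (real (m - l)) n x"
    unfolding degen_Euler_def
  proof (rule egf_coeffs_eq_fps_nth[symmetric])
    have "(\<lambda>t. \<Sum>B\<in>Pow {1..l}. 1 / 2 ^ l * (?g t * degen_exp lam (x + real (card B)) t))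
        has_fps_expansion ?H"
      by (intro has_fps_expansion_sum has_fps_expansion_mult has_fps_expansion_const G P)
    moreover have "\<forall>\<^sub>F t in nhds 0.
        (2 / (?e t + 1)) powr real (m - l) * degen_exp lam x t =
        (\<Sum>B\<in>Pow {1..l}. 1 / 2 ^ l * (?g t * degen_exp lam (x + real (card B)) t))"
      using ev
    proof eventually_elim
      case (elim t)
      let ?c = "(?e t + 1) / 2"
      have c: "?c > 0" using elim by simp
      \<comment> \<open>Here \<open>l \<le> m\<close> enters: it makes the truncated subtraction
        \<open>m - l\<close> the true difference of exponents.\<close>
      have cancel: "1 / c ^ m * c ^ l = (1 / c) ^ (m - l)" if "c > 0" for c :: real
        using that assms(5) by (simp add: power_diff power_divide)
      have "(\<Sum>B\<in>Pow {1..l}. 1 / 2 ^ l * (?g t * degen_exp lam (x + real (card B)) t))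
          = 1 / 2 ^ l * (?g t * degen_exp lam x t) * (\<Sum>B\<in>Pow {1..l}. ?e t ^ card B)"
        using elim by (simp add: sum_distrib_left sum_divide_distrib mult_ac)
      also have "\<dots> = ?g t * ?c ^ l * degen_exp lam x t"
        by (simp add: sum_Pow_power_card power_divide mult_ac)
      also have "?g t * ?c ^ l = (1 / ?c) ^ (m - l)"
        by (rule cancel[OF c])
      also have "\<dots> = (2 / (?e t + 1)) powr real (m - l)"
        using c by (subst powr_realpow) simp_all
      finally show ?case ..
    qed
    ultimately show "(\<lambda>t. (2 / (?e t + 1)) powr real (m - l) * degen_exp lam x t) has_fps_expansion ?H"
      by (rule has_fps_expansion_eventually_eq)
  qed
  finally show ?thesis .
qed

end
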